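(* Let $A,B\in\mathcal{B}(\mathcal{H})$ be two positive operators such that $n\le A\le N$ and $m\le B\le M$ for some positive real numbers $n<N$ and $m<M$. Let $f:(0,\infty)\to[0,\infty)$ be a convex function. Suppose that, for some $v\in(0,1)$, $$[(1-v)n+vm,\,(1-v)N+vM]\cap[n,N]=\varnothing\quad\text{and}\quad[(1-v)n+vm,\,(1-v)N+vM]\cap[m,M]=\varnothing.$$ Then $$f\big((1-v)A+vB\big)\le(1-v)f(A)+vf(B).$$ In particular, if $\left[\frac{n+m}{2},\,\frac{N+M}{2}\right]\cap[n,N]=\varnothing$ and $\left[\frac{n+m}{2},\,\frac{N+M}{2}\right]\cap[m,M]=\varnothing$ (the case $v=\tfrac12$), then $$f\left(\frac{A+B}{2}\right)\le\frac{f(A)+f(B)}{2}.$$ If instead $f:(0,\infty)\to[0,\infty)$ is concave (all other hypotheses being unchanged), the reverse inequalities hold.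
   Context: $\mathcal{B}(\mathcal{H})$ is the algebra of bounded linear operators on a complex Hilbert space $\mathcal{H}$. An operator $A$ is positive if $\langle Ax,x\rangle\ge0$ for all $x\in\mathcal{H}$. For self-adjoint operators, $A\ge B$ means that $A-B$ is positive; for scalars $m,M$, $m\le A\le M$ means $m\langle x,x\rangle\le\langle Ax,x\rangle\le M\langle x,x\rangle$ for all $x\in\mathcal{H}$. Expressions $f(A)$ are understood via the continuous functional calculus for self-adjoint operators. Convexity and concavity of $f$ are the ordinary scalar notions. *)

theory Defs
  imports "HOL-Analysis.Analysis" "HOL-Library.Complex_Order"
begin

text \<open>The inner product is linear in the first argument. Order relations between complex numbers
are those of \<open>HOL-Library.Complex_Order\<close>: \<open>z \<le> w\<close> means that \<open>w - z\<close> is real and nonnegative.\<close>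

class complex_inner = real_normed_vector +
  fixes scaleC :: "complex \<Rightarrow> 'a \<Rightarrow> 'a" (infixr "*\<^sub>C" 75)
    and cinner :: "'a \<Rightarrow> 'a \<Rightarrow> complex"
  assumes scaleC_add_right: "c *\<^sub>C (x + y) = c *\<^sub>C x + c *\<^sub>C y"
    and scaleC_add_left: "(c + d) *\<^sub>C x = c *\<^sub>C x + d *\<^sub>C x"
    and scaleC_scaleC: "c *\<^sub>C d *\<^sub>C x = (c * d) *\<^sub>C x"
    and scaleC_of_real: "complex_of_real r *\<^sub>C x = r *\<^sub>R x"
    and cinner_commute: "cinner x y = cnj (cinner y x)"
    and cinner_add_left: "cinner (x + y) z = cinner x z + cinner y z"
    and cinner_scaleC_left: "cinner (c *\<^sub>C x) y = c * cinner x y"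
    and cinner_self: "cinner x x = complex_of_real ((norm x)\<^sup>2)"

class complex_hilbert_space = complex_inner + complete_space

instantiation complex :: complex_hilbert_space
begin

definition scaleC_complex_def: "c *\<^sub>C (z :: complex) = c * z"
definition cinner_complex_def: "cinner (z :: complex) w = z * cnj w"

instance
  by standard
    (auto simp: scaleC_complex_def cinner_complex_def algebra_simps scaleR_conv_of_real
      complex_norm_square simp del: of_real_power)

end

text \<open>Elements of \<open>'a \<Rightarrow>\<^sub>L 'a\<close> are only real-linear; \<open>bounded_ops\<close> is the algebra of
bounded complex-linear operators.\<close>

definition bounded_ops :: "('a::complex_inner \<Rightarrow>\<^sub>L 'a) set" where
  "bounded_ops = {A :: 'a \<Rightarrow>\<^sub>L 'a. \<forall>c x. A (c *\<^sub>C x) = c *\<^sub>C A x}"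

definition self_adjoint :: "('a::complex_inner \<Rightarrow>\<^sub>L 'a) \<Rightarrow> bool" where
  "self_adjoint A \<longleftrightarrow> A \<in> bounded_ops \<and> (\<forall>x y. cinner (A x) y = cinner x (A y))"

definition positive_op :: "('a::complex_inner \<Rightarrow>\<^sub>L 'a) \<Rightarrow> bool" where
  "positive_op A \<longleftrightarrow> A \<in> bounded_ops \<and> (\<forall>x. 0 \<le> cinner (A x) x)"

definition op_le :: "('a::complex_inner \<Rightarrow>\<^sub>L 'a) \<Rightarrow> ('a \<Rightarrow>\<^sub>L 'a) \<Rightarrow> bool"
    (infix "\<le>\<^sub>o\<^sub>p" 50) where
  "A \<le>\<^sub>o\<^sub>p B \<longleftrightarrow> self_adjoint A \<and> self_adjoint B \<and> positive_op (B - A)"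

definition op_between :: "real \<Rightarrow> ('a::complex_inner \<Rightarrow>\<^sub>L 'a) \<Rightarrow> real \<Rightarrow> bool" where
  "op_between a A b \<longleftrightarrow>
     (\<forall>x. complex_of_real a * cinner x x \<le> cinner (A x) x \<and>
          cinner (A x) x \<le> complex_of_real b * cinner x x)"

definition op_spectrum :: "('a::complex_inner \<Rightarrow>\<^sub>L 'a) \<Rightarrow> complex set" where
  "op_spectrum A =
     {z. \<not> (\<exists>R\<in>bounded_ops. \<forall>x. R (A x - z *\<^sub>C x) = x \<and> A (R x) - z *\<^sub>C R x = x)}"

definition op_poly :: "real poly \<Rightarrow> ('a::complex_inner \<Rightarrow>\<^sub>L 'a) \<Rightarrow> ('a \<Rightarrow>\<^sub>L 'a)" where
  "op_poly p A = (\<Sum>i\<le>degree p. coeff p i *\<^sub>R (((o\<^sub>L) A ^^ i) id_blinfun))"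

text \<open>Continuous functional calculus of a self-adjoint \<open>A\<close> (whose spectrum is real): the map
\<open>f \<mapsto> f(A)\<close> is the continuous extension of \<open>p \<mapsto> p(A)\<close> from polynomials to the continuous functions
on the spectrum with the supremum norm. So \<open>f(A)\<close> is the norm limit of \<open>p\<^sub>k(A)\<close> for every sequence
of polynomials converging to \<open>f\<close> uniformly on the spectrum. The value is meaningful only when \<open>f\<close>
is continuous on the spectrum; values of \<open>f\<close> off the spectrum play no role.\<close>

definition fun_calc :: "(real \<Rightarrow> real) \<Rightarrow> ('a::complex_hilbert_space \<Rightarrow>\<^sub>L 'a) \<Rightarrow> ('a \<Rightarrow>\<^sub>L 'a)" where
  "fun_calc f A =
     (THE T. \<forall>p :: nat \<Rightarrow> real poly.
        uniform_limit {t. complex_of_real t \<in> op_spectrum A} (\<lambda>k. poly (p k)) f sequentially \<longrightarrow>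
        (\<lambda>k. op_poly (p k) A) \<longlonglongrightarrow> T)"

end

theory Submission
  imports Defs "HOL-Computational_Algebra.Fundamental_Theorem_Algebra"
begin

text \<open>The spectrum of \<open>C = (1 - v)A + vB\<close> lies in \<open>[L, U]\<close> with \<open>L = (1 - v)n + vm\<close> and
\<open>U = (1 - v)N + vM\<close>. The chord \<open>l\<close> of a convex \<open>f\<close> over \<open>[L, U]\<close> lies above \<open>f\<close> on \<open>[L, U]\<close> and
below \<open>f\<close> outside it, in particular on the spectra of \<open>A\<close> and \<open>B\<close>. As \<open>l\<close> is affine,
\<open>f(C) \<le> l(C) = (1 - v) l(A) + v l(B) \<le> (1 - v) f(A) + v f(B)\<close>. For concave \<open>f\<close> one takes \<open>- f\<close>.

Monotonicity of the functional calculus, and the fact that \<open>fun_calc\<close> is well defined, rest on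
the bound \<open>\<parallel>p(A)\<parallel> \<le> sup |p|\<close> over the spectrum for real polynomials \<open>p\<close>. If \<open>r = \<parallel>p(A)\<parallel>\<close> exceeded
the supremum, then \<open>p\<^sup>2 - r\<^sup>2\<close> would have no zero on the spectrum; factoring it into linear and
irreducible quadratic polynomials would show that \<open>p(A)\<^sup>2 - r\<^sup>2\<close> is bounded below, which the
definition of the operator norm forbids for self-adjoint \<open>p(A)\<close>.\<close>

section \<open>Self-adjoint operators and their order\<close>

text \<open>Makes \<open>'a \<Rightarrow>\<^sub>L 'a\<close> a complete space, so that Cauchy
  sequences of operators converge.\<close>

instance complex_hilbert_space \<subseteq> banach ..

lemma cinner_add_right: "cinner x (y + z) = cinner x y + cinner x (z::'a::complex_inner)"
  by (metis cinner_add_left cinner_commute complex_cnj_add)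

lemma cinner_scaleC_right: "cinner x (c *\<^sub>C y) = cnj c * cinner x (y::'a::complex_inner)"
  by (metis cinner_scaleC_left cinner_commute complex_cnj_mult)

lemma Re_cinner_commute: "Re (cinner x y) = Re (cinner y (x::'a::complex_inner))"
  by (metis cinner_commute complex_cnj(1) cnj.sel(1))

lemma norm_add_squared:
  "(norm (x + y))\<^sup>2 = (norm x)\<^sup>2 + 2 * Re (cinner x y) + (norm (y::'a::complex_inner))\<^sup>2"
proof -
  have "complex_of_real ((norm (x + y))\<^sup>2) = cinner (x + y) (x + y)"
    by (rule cinner_self [symmetric])
  also have "\<dots> = cinner x x + cinner x y + cinner y x + cinner y y"
    by (simp add: cinner_add_left cinner_add_right)
  finally have "Re (complex_of_real ((norm (x + y))\<^sup>2)) = Re (cinner x x + cinner x y + cinner y x + cinner y y)"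
    by simp
  then show ?thesis
    by (simp only: cinner_self Re_complex_of_real plus_complex.simps) (simp add: Re_cinner_commute)
qed

text \<open>The triangle inequality belongs to the norm structure; squaring and expanding it leaves
  the real part of Cauchy-Schwarz.\<close>

lemma Re_cinner_le: "Re (cinner x y) \<le> norm x * norm (y::'a::complex_inner)"
proof -
  have "(norm (x + y))\<^sup>2 \<le> (norm x + norm y)\<^sup>2"
    by (intro power_mono norm_triangle_ineq) auto
  then show ?thesis
    by (simp add: norm_add_squared power2_sum)
qed

lemma norm_scaleC: "norm (c *\<^sub>C x) = norm c * norm (x::'a::complex_inner)"
proof -
  have "complex_of_real ((norm (c *\<^sub>C x))\<^sup>2) = (c * cnj c) * cinner x x"
    by (simp only: cinner_self [symmetric] cinner_scaleC_left cinner_scaleC_right mult.assoc)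
       (simp add: mult.left_commute)
  also have "\<dots> = complex_of_real ((norm c * norm x)\<^sup>2)"
    by (simp add: cinner_self complex_norm_square power_mult_distrib flip: complex_norm_square)
  finally have "(norm (c *\<^sub>C x))\<^sup>2 = (norm c * norm x)\<^sup>2"
    using of_real_eq_iff by blast
  then show ?thesis
    by (simp add: power2_eq_iff_nonneg)
qed

lemma norm_cinner_le: "norm (cinner x y) \<le> norm x * norm (y::'a::complex_inner)"
proof (cases "cinner x y = 0")
  case False
  \<comment> \<open>The unimodular \<open>c\<close> rotates \<open>cinner x y\<close> onto the
    positive real axis, where the bound on real parts controls the modulus.\<close>
  define c where "c = cnj (sgn (cinner x y))"
  have nc: "norm c = 1"
    using False by (simp add: c_def norm_sgn)
  have "c * cinner x y = complex_of_real (norm (cinner x y))"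
    using False complex_norm_square [of "cinner x y"]
    by (simp add: c_def sgn_eq field_simps power2_eq_square)
  then have "norm (cinner x y) = Re (cinner (c *\<^sub>C x) y)"
    by (simp add: cinner_scaleC_left)
  also have "\<dots> \<le> norm x * norm y"
    using Re_cinner_le [of "c *\<^sub>C x" y] nc by (simp add: norm_scaleC)
  finally show ?thesis .
qed simp

interpretation cinner: bounded_bilinear "cinner :: 'a::complex_inner \<Rightarrow> 'a \<Rightarrow> complex"
proof
  show "\<exists>K. \<forall>a b :: 'a. norm (cinner a b) \<le> norm a * norm b * K"
    by (intro exI [of _ 1]) (simp add: norm_cinner_le)
  fix x y :: 'a and r :: real
  show "cinner (r *\<^sub>R x) y = r *\<^sub>R cinner x y" "cinner x (r *\<^sub>R y) = r *\<^sub>R cinner x y"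
    using cinner_scaleC_left [of "complex_of_real r" x y] cinner_scaleC_right [of x "complex_of_real r" y]
    by (simp_all add: scaleC_of_real scaleR_conv_of_real)
qed (simp_all add: cinner_add_left cinner_add_right)

interpretation scaleC: bounded_bilinear "scaleC :: complex \<Rightarrow> 'a::complex_inner \<Rightarrow> 'a"
proof
  show "\<exists>K. \<forall>c. \<forall>x :: 'a. norm (c *\<^sub>C x) \<le> norm c * norm x * K"
    by (intro exI [of _ 1]) (simp add: norm_scaleC)
  fix c :: complex and x :: 'a and r :: real
  show "(r *\<^sub>R c) *\<^sub>C x = r *\<^sub>R c *\<^sub>C x" "c *\<^sub>C r *\<^sub>R x = r *\<^sub>R c *\<^sub>C x"
    using scaleC_scaleC [of "complex_of_real r" c x] scaleC_scaleC [of c "complex_of_real r" x]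
    by (simp_all add: scaleC_of_real scaleR_conv_of_real mult.commute)
qed (simp_all add: scaleC_add_right scaleC_add_left)

section \<open>Closure properties of self-adjoint operators\<close>

lemma self_adjointD: "self_adjoint A \<Longrightarrow> cinner (A x) y = cinner x (A y)"
  by (simp add: self_adjoint_def)

lemma self_adjoint_id: "self_adjoint id_blinfun"
  by (simp add: self_adjoint_def bounded_ops_def)

lemma self_adjoint_zero: "self_adjoint 0"
  by (simp add: self_adjoint_def bounded_ops_def scaleC.zero_right cinner.zero_left cinner.zero_right)

lemma self_adjoint_add: "self_adjoint A \<Longrightarrow> self_adjoint B \<Longrightarrow> self_adjoint (A + B)"
  by (simp add: self_adjoint_def bounded_ops_def blinfun.add_left scaleC_add_right
      cinner.add_left cinner.add_right)

lemma self_adjoint_scaleR: "self_adjoint A \<Longrightarrow> self_adjoint (r *\<^sub>R A)"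
  by (simp add: self_adjoint_def bounded_ops_def blinfun.scaleR_left scaleC.scaleR_right
      cinner.scaleR_left cinner.scaleR_right)

lemma self_adjoint_uminus: "self_adjoint A \<Longrightarrow> self_adjoint (- A)"
  using self_adjoint_scaleR [of A "-1"] by simp

lemma self_adjoint_diff: "self_adjoint A \<Longrightarrow> self_adjoint B \<Longrightarrow> self_adjoint (A - B)"
  using self_adjoint_add [OF _ self_adjoint_uminus, of A B] by simp

text \<open>Norm convergence implies pointwise convergence, and both defining identities survive
  pointwise limits.\<close>

lemma self_adjoint_LIMSEQ:
  assumes "\<And>k. self_adjoint (T k)" and "T \<longlonglongrightarrow> L"
  shows "self_adjoint L"
proof -
  have lim: "(\<lambda>k. T k x) \<longlonglongrightarrow> L x" for x
    by (intro blinfun.tendsto assms tendsto_const)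
  have "L (c *\<^sub>C x) = c *\<^sub>C L x" for c x
  proof (rule LIMSEQ_unique [OF lim])
    have "T k (c *\<^sub>C x) = c *\<^sub>C T k x" for k
      using assms(1) by (simp add: self_adjoint_def bounded_ops_def)
    then show "(\<lambda>k. T k (c *\<^sub>C x)) \<longlonglongrightarrow> c *\<^sub>C L x"
      by (simp add: scaleC.tendsto [OF tendsto_const] lim)
  qed
  moreover have "cinner (L x) y = cinner x (L y)" for x y
  proof (rule LIMSEQ_unique)
    show "(\<lambda>k. cinner (T k x) y) \<longlonglongrightarrow> cinner (L x) y"
      by (intro cinner.tendsto lim tendsto_const)
    show "(\<lambda>k. cinner (T k x) y) \<longlonglongrightarrow> cinner x (L y)"
      unfolding self_adjointD [OF assms(1)] by (intro cinner.tendsto lim tendsto_const)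
  qed
  ultimately show ?thesis
    by (simp add: self_adjoint_def bounded_ops_def)
qed

lemma self_adjoint_Im_cinner: "self_adjoint A \<Longrightarrow> Im (cinner (A x) x) = 0"
  by (metis cinner_commute self_adjointD Reals_cnj_iff complex_is_Real_iff)

text \<open>Polarisation: the numbers \<open>\<langle>A (x + y), x + y\<rangle>\<close> and \<open>\<langle>A (x + \<i> y), x + \<i> y\<rangle>\<close> are real.\<close>

lemma positive_op_imp_self_adjoint:
  assumes "positive_op A"
  shows "self_adjoint A"
proof -
  have A: "A \<in> bounded_ops" and pos: "\<And>x. 0 \<le> cinner (A x) x"
    using assms by (auto simp: positive_op_def)
  have im: "Im (cinner (A x) x) = 0" for x
    using pos [of x] by (simp add: less_eq_complex_def)
  have sc: "A (c *\<^sub>C x) = c *\<^sub>C A x" for c x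
    using A by (simp add: bounded_ops_def)
  have "cinner (A x) y = cinner x (A y)" for x y
  proof -
    have "Im (cinner (A x) y) + Im (cinner (A y) x) = 0"
      using im [of "x + y"] im [of x] im [of y]
      by (simp add: blinfun.add_right cinner_add_left cinner_add_right)
    moreover have "Re (cinner (A y) x) - Re (cinner (A x) y) = 0"
      using im [of "x + \<i> *\<^sub>C y"] im [of x] im [of y]
      by (simp add: blinfun.add_right cinner_add_left cinner_add_right sc cinner_scaleC_left
          cinner_scaleC_right)
    ultimately have "cinner (A x) y = cnj (cinner (A y) x)"
      by (simp add: complex_eq_iff)
    then show ?thesis
      by (metis cinner_commute)
  qed
  with A show ?thesis
    by (simp add: self_adjoint_def)
qed

text \<open>Quadratic forms of self-adjoint operators are real, so the order reduces to real
  inequalities.\<close>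

lemma op_le_iff:
  "S \<le>\<^sub>o\<^sub>p T \<longleftrightarrow>
    self_adjoint S \<and> self_adjoint T \<and> (\<forall>x. Re (cinner (S x) x) \<le> Re (cinner (T x) x))"
proof (cases "self_adjoint S \<and> self_adjoint T")
  case True
  then have "self_adjoint (T - S)"
    by (simp add: self_adjoint_diff)
  then have bops: "T - S \<in> bounded_ops" and im: "\<And>x. Im (cinner ((T - S) x) x) = 0"
    by (auto simp: self_adjoint_Im_cinner) (simp add: self_adjoint_def)
  have "Re (cinner ((T - S) x) x) = Re (cinner (T x) x) - Re (cinner (S x) x)" for x
    by (simp add: blinfun.diff_left cinner.diff_left)
  with bops im have "positive_op (T - S) \<longleftrightarrow> (\<forall>x. Re (cinner (S x) x) \<le> Re (cinner (T x) x))"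
    by (simp add: positive_op_def less_eq_complex_def)
  then show ?thesis
    using True by (simp add: op_le_def)
qed (auto simp: op_le_def)

lemma op_between_iff:
  assumes "self_adjoint A"
  shows "op_between a A b \<longleftrightarrow>
    (\<forall>x. a * (norm x)\<^sup>2 \<le> Re (cinner (A x) x) \<and> Re (cinner (A x) x) \<le> b * (norm x)\<^sup>2)"
  using assms by (simp add: op_between_def less_eq_complex_def self_adjoint_Im_cinner cinner_self
      flip: of_real_mult of_real_power)

lemma op_le_trans: "S \<le>\<^sub>o\<^sub>p T \<Longrightarrow> T \<le>\<^sub>o\<^sub>p U \<Longrightarrow> S \<le>\<^sub>o\<^sub>p U"
  unfolding op_le_iff by (blast intro: order_trans)

lemma op_le_uminus_iff: "- S \<le>\<^sub>o\<^sub>p - T \<longleftrightarrow> T \<le>\<^sub>o\<^sub>p S"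
  using self_adjoint_uminus [of S] self_adjoint_uminus [of "- S"]
    self_adjoint_uminus [of T] self_adjoint_uminus [of "- T"]
  by (auto simp: op_le_iff blinfun.minus_left cinner.minus_left)

lemma op_le_convex_combination:
  assumes "S \<le>\<^sub>o\<^sub>p S'" "T \<le>\<^sub>o\<^sub>p T'" "0 \<le> v" "v \<le> 1"
  shows "(1 - v) *\<^sub>R S + v *\<^sub>R T \<le>\<^sub>o\<^sub>p (1 - v) *\<^sub>R S' + v *\<^sub>R T'"
  using assms
  by (auto simp: op_le_iff self_adjoint_add self_adjoint_scaleR blinfun.add_left blinfun.scaleR_left
      cinner.add_left cinner.scaleR_left intro!: add_mono mult_left_mono)

lemma op_between_convex_combination:
  assumes "self_adjoint A" "self_adjoint B" "op_between n A N" "op_between m B M" "0 \<le> v" "v \<le> 1"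
  shows "op_between ((1 - v) * n + v * m) ((1 - v) *\<^sub>R A + v *\<^sub>R B) ((1 - v) * N + v * M)"
proof -
  have "((1 - v) * n + v * m) * (norm x)\<^sup>2 \<le> (1 - v) * Re (cinner (A x) x) + v * Re (cinner (B x) x) \<and>
    (1 - v) * Re (cinner (A x) x) + v * Re (cinner (B x) x) \<le> ((1 - v) * N + v * M) * (norm x)\<^sup>2" for x
    unfolding distrib_right mult.assoc
    using assms by (intro conjI add_mono mult_left_mono) (auto simp: op_between_iff)
  then show ?thesis
    using assms by (simp add: op_between_iff self_adjoint_add self_adjoint_scaleR blinfun.add_left
        blinfun.scaleR_left cinner.add_left cinner.scaleR_left)
qed

section \<open>Coercive operators and the real spectrum\<close>

text \<open>The Lax-Milgram argument: coercivity gives injectivity and a bounded inverse, the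
  contraction principle gives surjectivity.\<close>

lemma coercive_invertible:
  fixes T :: "'a::complex_hilbert_space \<Rightarrow>\<^sub>L 'a"
  assumes T: "T \<in> bounded_ops" and "0 < c" and coercive: "\<And>x. c * (norm x)\<^sup>2 \<le> Re (cinner (T x) x)"
  obtains R where "R \<in> bounded_ops" "\<And>x. R (T x) = x" "\<And>x. T (R x) = x"
proof -
  have below: "c * norm x \<le> norm (T x)" for x
  proof -
    have "c * norm x * norm x \<le> norm (T x) * norm x"
      using coercive [of x] Re_cinner_le [of "T x" x] by (simp add: power2_eq_square mult.assoc)
    then show ?thesis
      by (cases "x = 0") (auto dest: mult_right_le_imp_le)
  qed
  have inj: "x = y" if "T x = T y" for x y
    using below [of "x - y"] that \<open>0 < c\<close> by (simp add: blinfun.diff_right mult_le_0_iff)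
  \<comment> \<open>The summand \<open>c\<close> ensures \<open>0 < K\<close> and
    \<open>c \<le> K\<close>. The squared contraction factor is bounded by
    \<open>1 - 2 * s * c + s\<^sup>2 * K\<^sup>2\<close>, which is minimal at
    \<open>s = c / K\<^sup>2\<close> with minimum \<open>q\<close>.\<close>
  define K where "K = norm T + c"
  define s where "s = c / K\<^sup>2"
  define q where "q = 1 - (c / K)\<^sup>2"
  have K: "0 < K" "c \<le> K" "norm T \<le> K"
    using \<open>0 < c\<close> by (auto simp: K_def add_nonneg_pos)
  have s: "0 < s"
    using K \<open>0 < c\<close> by (simp add: s_def)
  have q: "0 \<le> q" "q < 1"
    using K \<open>0 < c\<close> by (auto simp: q_def power_le_one)
  have contr: "norm (x - s *\<^sub>R T x) \<le> sqrt q * norm x" for x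
  proof -
    have "(norm (x - s *\<^sub>R T x))\<^sup>2 = (norm x)\<^sup>2 - 2 * s * Re (cinner (T x) x) + s\<^sup>2 * (norm (T x))\<^sup>2"
      using norm_add_squared [of x "- (s *\<^sub>R T x)"]
      by (simp add: cinner.minus_right cinner.scaleR_right power_mult_distrib Re_cinner_commute [of x])
    also have "\<dots> \<le> (norm x)\<^sup>2 - 2 * s * (c * (norm x)\<^sup>2) + s\<^sup>2 * (K * norm x)\<^sup>2"
    proof (intro add_mono diff_mono mult_left_mono power_mono coercive)
      show "norm (T x) \<le> K * norm x"
        by (meson K(3) norm_blinfun mult_right_mono norm_ge_zero order_trans)
    qed (use s in auto)
    also have "\<dots> = q * (norm x)\<^sup>2"
      using K by (simp add: s_def q_def field_simps power2_eq_square)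
    also have "\<dots> = (sqrt q * norm x)\<^sup>2"
      using q by (simp add: power_mult_distrib)
    finally show ?thesis
      by (rule power2_le_imp_le) (use q in simp)
  qed
  have surj: "\<exists>x. T x = y" for y
  proof -
    \<comment> \<open>As \<open>0 < s\<close>, the fixed points of this map are exactly the
      solutions of \<open>T x = y\<close>.\<close>
    have "dist (x - s *\<^sub>R (T x - y)) (z - s *\<^sub>R (T z - y)) \<le> sqrt q * dist x z" for x z
      using contr [of "x - z"] by (simp add: dist_norm blinfun.diff_right algebra_simps)
    with q have "\<exists>!x. x - s *\<^sub>R (T x - y) = x"
      by (intro banach_fix_type [of "sqrt q"]) auto
    then show ?thesis
      using s by auto
  qed
  define R where "R y = (SOME x. T x = y)" for y
  have TR: "T (R y) = y" for y
    unfolding R_def using someI_ex [OF surj] .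
  have RT: "R (T x) = x" for x
    by (rule inj) (rule TR)
  have lin: "bounded_linear R"
  proof
    show "R (x + y) = R x + R y" "R (r *\<^sub>R x) = r *\<^sub>R R x" for x y r
      by (rule inj, simp add: TR blinfun.add_right blinfun.scaleR_right)+
    show "\<exists>K. \<forall>x. norm (R x) \<le> norm x * K"
      using below [of "R _"] \<open>0 < c\<close> by (intro exI [of _ "1 / c"]) (simp add: TR field_simps)
  qed
  have "R (a *\<^sub>C x) = a *\<^sub>C R x" for a x
    by (rule inj) (use T in \<open>simp add: TR bounded_ops_def\<close>)
  then show ?thesis
    using that [of "Blinfun R"] TR RT by (simp add: bounded_linear_Blinfun_apply [OF lin] bounded_ops_def)
qed

abbreviation real_spectrum :: "('a::complex_inner \<Rightarrow>\<^sub>L 'a) \<Rightarrow> real set" where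
  "real_spectrum A \<equiv> {t. complex_of_real t \<in> op_spectrum A}"

text \<open>For \<open>t < a\<close> the operator \<open>A - t\<close> is coercive with constant
  \<open>a - t\<close>; for \<open>t > b\<close> so is \<open>t - A\<close> with constant
  \<open>t - b\<close>. Either way \<open>t\<close> has a bounded resolvent.\<close>

lemma real_spectrum_subset:
  fixes A :: "'a::complex_hilbert_space \<Rightarrow>\<^sub>L 'a"
  assumes A: "self_adjoint A" and ab: "op_between a A b"
  shows "real_spectrum A \<subseteq> {a..b}"
proof
  fix t assume t: "t \<in> real_spectrum A"
  have bops: "A - t *\<^sub>R id_blinfun \<in> bounded_ops" "t *\<^sub>R id_blinfun - A \<in> bounded_ops"
    using A self_adjoint_diff self_adjoint_id self_adjoint_scaleR self_adjoint_def by blast+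
  have self: "Re (cinner x x) = (norm x)\<^sup>2" for x :: 'a
    by (simp add: cinner_self)
  have spec: "\<not> (\<exists>R\<in>bounded_ops. \<forall>x. R (A x - t *\<^sub>R x) = x \<and> A (R x) - t *\<^sub>R R x = x)"
    using t by (simp add: op_spectrum_def scaleC_of_real)
  have quad: "a * (norm x)\<^sup>2 \<le> Re (cinner (A x) x)" "Re (cinner (A x) x) \<le> b * (norm x)\<^sup>2" for x
    using ab A by (auto simp: op_between_iff)
  show "t \<in> {a..b}"
  proof (rule ccontr)
    assume "t \<notin> {a..b}"
    then consider "0 < a - t" | "0 < t - b"
      by force
    then show False
    proof cases
      case 1
      have "(a - t) * (norm x)\<^sup>2 \<le> Re (cinner ((A - t *\<^sub>R id_blinfun) x) x)" for x
        using quad(1) [of x]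
        by (simp add: blinfun.diff_left blinfun.scaleR_left cinner.diff_left cinner.scaleR_left self
            left_diff_distrib)
      then obtain R where "R \<in> bounded_ops" "\<And>x. R ((A - t *\<^sub>R id_blinfun) x) = x"
          "\<And>x. (A - t *\<^sub>R id_blinfun) (R x) = x"
        using coercive_invertible [OF bops(1) 1] by metis
      then show False
        using spec by (auto simp: blinfun.diff_left blinfun.scaleR_left)
    next
      case 2
      have "(t - b) * (norm x)\<^sup>2 \<le> Re (cinner ((t *\<^sub>R id_blinfun - A) x) x)" for x
        using quad(2) [of x]
        by (simp add: blinfun.diff_left blinfun.scaleR_left cinner.diff_left cinner.scaleR_left self
            left_diff_distrib)
      then obtain R where R: "R \<in> bounded_ops" "\<And>x. R ((t *\<^sub>R id_blinfun - A) x) = x"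
          "\<And>x. (t *\<^sub>R id_blinfun - A) (R x) = x"
        using coercive_invertible [OF bops(2) 2] by metis
      \<comment> \<open>\<open>R\<close> inverts \<open>t - A\<close>, while the spectrum is defined
        through \<open>A - t\<close>; hence the sign.\<close>
      have "- R \<in> bounded_ops"
        using R(1) by (simp add: bounded_ops_def blinfun.minus_left scaleC.minus_right)
      moreover have "(- R) (A x - t *\<^sub>R x) = x" "A ((- R) x) - t *\<^sub>R (- R) x = x" for x
        using R(2,3) [of x]
        by (simp_all add: blinfun.diff_left blinfun.scaleR_left blinfun.minus_left blinfun.minus_right
            blinfun.diff_right)
      ultimately show False
        using spec by blast
    qed
  qed
qed

section \<open>Polynomials of a self-adjoint operator\<close>

lemma op_poly_0: "op_poly 0 A = 0"
  by (simp add: op_poly_def)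

text \<open>Horner's recursion, which opens the algebra of \<open>op_poly\<close> to induction on
  polynomials.\<close>

lemma op_poly_pCons: "op_poly (pCons a p) A = a *\<^sub>R id_blinfun + (A o\<^sub>L op_poly p A)"
proof (cases "p = 0")
  case True
  then show ?thesis
    by (intro blinfun_eqI) (simp add: op_poly_def blinfun.add_left)
next
  case False
  show ?thesis
    unfolding op_poly_def degree_pCons_eq [OF False] sum.atMost_Suc_shift
    by (intro blinfun_eqI)
       (simp add: blinfun.add_left blinfun.sum_left blinfun.sum_right blinfun.scaleR_left blinfun.scaleR_right)
qed

lemma op_poly_pCons_apply: "op_poly (pCons a p) A x = a *\<^sub>R x + A (op_poly p A x)"
  by (simp add: op_poly_pCons blinfun.add_left blinfun.scaleR_left)

lemma op_poly_add: "op_poly (p + q) A = op_poly p A + op_poly q A"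
proof (induction p q rule: poly_induct2)
  case (pCons a p b q)
  then show ?case
    by (intro blinfun_eqI) (simp add: op_poly_pCons_apply blinfun.add_left blinfun.add_right algebra_simps)
qed (simp add: op_poly_0)

lemma op_poly_smult: "op_poly (smult c p) A = c *\<^sub>R op_poly p A"
proof (induction p)
  case (pCons a p)
  then show ?case
    by (intro blinfun_eqI)
       (simp add: op_poly_pCons_apply blinfun.scaleR_left blinfun.scaleR_right scaleR_add_right)
qed (simp add: op_poly_0)

lemma op_poly_diff: "op_poly (p - q) A = op_poly p A - op_poly q A"
proof -
  have "p - q = p + smult (- 1) q"
    by simp
  then show ?thesis
    by (simp only: op_poly_add op_poly_smult) simp
qed

lemma op_poly_mult: "op_poly (p * q) A = op_poly p A o\<^sub>L op_poly q A"
proof (induction p)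
  case (pCons a p)
  then show ?case
    by (intro blinfun_eqI)
       (simp add: op_poly_add op_poly_smult op_poly_pCons_apply blinfun.add_left blinfun.scaleR_left)
qed (simp add: op_poly_0 blinfun_eqI)

lemma op_poly_const: "op_poly [:c:] A = c *\<^sub>R id_blinfun"
  by (simp add: op_poly_pCons op_poly_0 blinfun_eqI)

text \<open>Needed because a product of self-adjoint operators is self-adjoint only if they
  commute.\<close>

lemma op_poly_commute: "op_poly p A (A x) = A (op_poly p A x)"
  by (induction p) (simp_all add: op_poly_0 op_poly_pCons_apply blinfun.add_right blinfun.scaleR_right)

lemma self_adjoint_op_poly:
  assumes "self_adjoint A"
  shows "self_adjoint (op_poly p A)"
proof (induction p)
  case (pCons a p)
  have "self_adjoint (A o\<^sub>L op_poly p A)"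
    using assms pCons.IH by (simp add: self_adjoint_def bounded_ops_def op_poly_commute)
  then show ?case
    by (simp add: op_poly_pCons self_adjoint_add self_adjoint_scaleR self_adjoint_id)
qed (simp add: op_poly_0 self_adjoint_zero)

text \<open>A complex root exists by the fundamental theorem of algebra. A real one gives a linear
  factor, a nonreal one pairs with its conjugate.\<close>

lemma real_poly_factor:
  fixes q :: "real poly"
  assumes "0 < degree q"
  obtains (linear) a where "[:- a, 1:] dvd q"
  | (quadratic) a b where "b \<noteq> 0" "[:a\<^sup>2 + b\<^sup>2, - 2 * a, 1:] dvd q"
proof -
  define ev where "ev p z = poly (map_poly complex_of_real p) z" for p z
  have ev_0 [simp]: "ev 0 z = 0" for z
    by (simp add: ev_def)
  have ev_pCons [simp]: "ev (pCons a p) z = of_real a + z * ev p z" for a p z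
    by (simp add: ev_def map_poly_pCons)
  have ev_add: "ev (p + r) z = ev p z + ev r z" for p r z
    by (induction p r rule: poly_induct2) (simp_all add: algebra_simps)
  have ev_smult: "ev (smult a p) z = of_real a * ev p z" for a p z
    by (induction p) (simp_all add: algebra_simps)
  have ev_mult: "ev (p * r) z = ev p z * ev r z" for p r z
    by (induction p) (simp_all add: ev_add ev_smult algebra_simps)
  have "\<not> constant (poly (map_poly complex_of_real q))"
    using assms by (simp add: constant_degree degree_map_poly)
  then obtain z where z: "ev q z = 0"
    unfolding ev_def using fundamental_theorem_of_algebra by blast
  show ?thesis
  proof (cases "Im z = 0")
    case True
    have "ev p (of_real x) = of_real (poly p x)" for p x
      by (induction p) simp_all
    moreover have "z = of_real (Re z)"
      using True by (simp add: complex_eq_iff)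
    ultimately have "poly q (Re z) = 0"
      using z by (metis of_real_eq_0_iff)
    then show ?thesis
      using linear by (simp add: poly_eq_0_iff_dvd)
  next
    case False
    \<comment> \<open>This is the product of \<open>t - z\<close> and
      \<open>t - cnj z\<close>.\<close>
    define d where "d = [:(Re z)\<^sup>2 + (Im z)\<^sup>2, - 2 * Re z, 1:]"
    have "degree (q mod d) < 2"
      using degree_mod_less [of d q] by (auto simp: d_def)
    then have "q mod d = [:coeff (q mod d) 0, coeff (q mod d) 1:]"
      by (intro poly_eqI) (auto simp: coeff_pCons coeff_eq_0 split: nat.split)
    then obtain u w where uw: "q mod d = [:u, w:]"
      by blast
    have "ev d z = 0"
      by (simp add: d_def complex_eq_iff power2_eq_square algebra_simps)
    then have "ev (q mod d) z = 0"
      using z ev_add [of "q div d * d" "q mod d" z] by (simp add: ev_mult)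
    \<comment> \<open>The remainder is \<open>u + w * z\<close> at the nonreal \<open>z\<close>: its
      imaginary part forces \<open>w = 0\<close>, then \<open>u = 0\<close>.\<close>
    then have "q mod d = 0"
      using False by (auto simp: uw complex_eq_iff)
    then show ?thesis
      using quadratic False unfolding d_def by (simp add: mod_eq_0_iff_dvd)
  qed
qed

text \<open>Induction on the degree, since lower bounds of factors multiply. A linear factor is
  controlled by the resolvent at its root, a quadratic factor
  \<open>(A - a)\<^sup>2 + b\<^sup>2\<close> by its quadratic form.\<close>

lemma op_poly_bounded_below:
  assumes A: "self_adjoint A"
    and "q \<noteq> 0" and "\<And>t. t \<in> real_spectrum A \<Longrightarrow> poly q t \<noteq> 0"
  shows "\<exists>c>0. \<forall>x. c * norm x \<le> norm (op_poly q A x)"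
  using assms(2,3)
proof (induction "degree q" arbitrary: q rule: less_induct)
  case less
  have step: ?case if "d dvd q" "0 < degree d"
    and d: "0 < c" "\<And>x. c * norm x \<le> norm (op_poly d A x)" for d c
  proof -
    obtain e where q: "q = d * e"
      using \<open>d dvd q\<close> by (rule dvdE)
    with less.prems have e: "e \<noteq> 0" "d \<noteq> 0" "\<And>t. t \<in> real_spectrum A \<Longrightarrow> poly e t \<noteq> 0"
      by auto
    then have "degree e < degree q"
      using \<open>0 < degree d\<close> by (simp add: q degree_mult_eq)
    with less.hyps e obtain c' where c': "0 < c'" "\<And>x. c' * norm x \<le> norm (op_poly e A x)"
      by blast
    have "c * c' * norm x \<le> norm (op_poly q A x)" for x
    proof -
      have "c * c' * norm x \<le> c * norm (op_poly e A x)"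
        using c'(2) [of x] \<open>0 < c\<close> by (simp add: mult.assoc)
      also have "\<dots> \<le> norm (op_poly q A x)"
        using d(2) [of "op_poly e A x"] by (simp add: q op_poly_mult)
      finally show ?thesis .
    qed
    then show ?thesis
      using \<open>0 < c\<close> c'(1) by (intro exI [of _ "c * c'"]) simp
  qed
  show ?case
  proof (cases "degree q = 0")
    case True
    then obtain a where "q = [:a:]"
      by (rule degree_eq_zeroE)
    with \<open>q \<noteq> 0\<close> show ?thesis
      by (intro exI [of _ "\<bar>a\<bar>"]) (simp add: op_poly_const blinfun.scaleR_left)
  next
    case False
    then have "0 < degree q"
      by simp
    then show ?thesis
    proof (cases rule: real_poly_factor)
      case (linear a)
      then have "poly q a = 0"
        by (simp add: poly_eq_0_iff_dvd)
      then have "complex_of_real a \<notin> op_spectrum A"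
        using less.prems(2) by blast
      then obtain R :: "'a \<Rightarrow>\<^sub>L 'a" where R: "\<And>x. R (A x - a *\<^sub>R x) = x"
        by (auto simp: op_spectrum_def scaleC_of_real)
      have eq: "op_poly [:- a, 1:] A x = A x - a *\<^sub>R x" for x
        by (simp add: op_poly_pCons_apply op_poly_0)
      show ?thesis
      proof (rule step [OF linear])
        \<comment> \<open>Adding 1 keeps the denominator positive even when
          \<open>R = 0\<close>.\<close>
        have pos: "0 < norm R + 1"
          by (simp add: add_nonneg_pos)
        then show "0 < 1 / (norm R + 1)"
          by simp
        have "norm x \<le> (norm R + 1) * norm (A x - a *\<^sub>R x)" for x
          using norm_blinfun [of R "A x - a *\<^sub>R x"]
          by (simp add: R distrib_right add_increasing2)
        then show "1 / (norm R + 1) * norm x \<le> norm (op_poly [:- a, 1:] A x)" for x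
          using pos by (simp add: eq field_simps)
      qed simp
    next
      case (quadratic a b)
      show ?thesis
      proof (rule step [OF quadratic(2)])
        show "0 < b\<^sup>2"
          using quadratic(1) by simp
        fix x
        \<comment> \<open>With \<open>y = (A - a) x\<close> one has
          \<open>z = (A - a) y + b\<^sup>2 x\<close>, so pairing \<open>z\<close> with
          \<open>x\<close> gives the squared norm of \<open>y\<close> plus \<open>b\<^sup>2\<close>
          times that of \<open>x\<close>.\<close>
        define y where "y = A x - a *\<^sub>R x"
        define z where "z = op_poly [:a\<^sup>2 + b\<^sup>2, - 2 * a, 1:] A x"
        have "z = A y - a *\<^sub>R y + b\<^sup>2 *\<^sub>R x"
          by (simp add: z_def y_def op_poly_pCons_apply op_poly_0 blinfun.add_right blinfun.diff_right
              blinfun.scaleR_right algebra_simps power2_eq_square flip: scaleR_2)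
        then have "cinner z x = cinner y y + b\<^sup>2 *\<^sub>R cinner x x"
          by (simp add: cinner.add_left cinner.diff_left cinner.scaleR_left self_adjointD [OF A]
              y_def cinner.diff_right cinner.scaleR_right)
        then have "b\<^sup>2 * (norm x)\<^sup>2 \<le> Re (cinner z x)"
          by (simp add: cinner_self flip: of_real_power)
        also have "\<dots> \<le> norm z * norm x"
          by (rule Re_cinner_le)
        finally have "b\<^sup>2 * norm x * norm x \<le> norm z * norm x"
          by (simp add: power2_eq_square mult.assoc)
        then show "b\<^sup>2 * norm x \<le> norm z"
          by (cases "x = 0") (auto dest: mult_right_le_imp_le)
      qed simp
    qed
  qed
qed

text \<open>Approximate eigenvectors: \<open>\<parallel>T x\<parallel>\<close> nearly attains \<open>\<parallel>T\<parallel>\<close> for suitable unit vectors \<open>x\<close>, and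
there \<open>T\<^sup>2 x \<approx> \<parallel>T\<parallel>\<^sup>2 x\<close>.\<close>

lemma square_minus_norm_not_bounded_below:
  fixes T :: "'a::complex_inner \<Rightarrow>\<^sub>L 'a"
    and x\<^sub>0 :: 'a
  assumes T: "self_adjoint T" and "x\<^sub>0 \<noteq> 0" and "0 < c"
  shows "\<exists>x. norm (T (T x) - (norm T)\<^sup>2 *\<^sub>R x) < c * norm x"
proof (rule ccontr)
  assume "\<not> ?thesis"
  then have below: "c * norm x \<le> norm (T (T x) - (norm T)\<^sup>2 *\<^sub>R x)" for x
    by (simp add: not_less)
  define r where "r = norm T"
  have est: "c\<^sup>2 * (norm x)\<^sup>2 \<le> r\<^sup>2 * (r\<^sup>2 * (norm x)\<^sup>2 - (norm (T x))\<^sup>2)" for x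
  proof -
    have "(c * norm x)\<^sup>2 \<le> (norm (T (T x) - r\<^sup>2 *\<^sub>R x))\<^sup>2"
      unfolding r_def using \<open>0 < c\<close> by (intro power_mono below) simp
    also have "\<dots> = (norm (T (T x)))\<^sup>2 - 2 * r\<^sup>2 * Re (cinner (T (T x)) x) + (r\<^sup>2 * norm x)\<^sup>2"
      using norm_add_squared [of "T (T x)" "- (r\<^sup>2 *\<^sub>R x)"]
      by (simp add: cinner.minus_right cinner.scaleR_right)
    also have "Re (cinner (T (T x)) x) = (norm (T x))\<^sup>2"
      by (simp add: self_adjointD [OF T] cinner_self flip: of_real_power)
    also have "(norm (T (T x)))\<^sup>2 \<le> (r * norm (T x))\<^sup>2"
      unfolding r_def by (intro power_mono norm_blinfun) simp
    finally show ?thesis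
      by (simp add: power_mult_distrib algebra_simps power2_eq_square)
  qed
  show False
  proof (cases "r = 0")
    case True
    then show False
      using est [of x\<^sub>0] assms by (simp add: mult_le_0_iff)
  next
    case False
    then have "0 < r"
      by (simp add: r_def)
    \<comment> \<open>Dividing \<open>est\<close> by \<open>r\<^sup>2\<close> bounds the squared
      norm of \<open>T x\<close> by \<open>s\<close> times that of \<open>x\<close>. As
      \<open>s < r\<^sup>2\<close>, this contradicts \<open>r = norm T\<close>.\<close>
    define s where "s = r\<^sup>2 - (c / r)\<^sup>2"
    have s: "(norm (T x))\<^sup>2 \<le> s * (norm x)\<^sup>2" for x
      using est [of x] \<open>0 < r\<close> by (simp add: s_def field_simps power2_eq_square)
    have "0 \<le> s * (norm x\<^sub>0)\<^sup>2"
      using s [of x\<^sub>0] by (meson order_trans zero_le_power2)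
    then have "0 \<le> s"
      using \<open>x\<^sub>0 \<noteq> 0\<close> by (simp add: zero_le_mult_iff)
    have "norm T \<le> sqrt s"
    proof (rule norm_blinfun_bound)
      fix x
      have "(norm (T x))\<^sup>2 \<le> (sqrt s * norm x)\<^sup>2"
        using s [of x] \<open>0 \<le> s\<close> by (simp add: power_mult_distrib)
      then show "norm (T x) \<le> sqrt s * norm x"
        by (rule power2_le_imp_le) (use \<open>0 \<le> s\<close> in simp)
    qed (use \<open>0 \<le> s\<close> in simp)
    then have "r\<^sup>2 \<le> s"
      using \<open>0 \<le> s\<close> by (metis r_def norm_ge_zero power_mono real_sqrt_pow2)
    then show False
      using \<open>0 < c\<close> \<open>0 < r\<close> by (simp add: s_def power_divide) (simp add: field_simps)
  qed
qed

lemma norm_op_poly_le: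
  fixes A :: "'a::complex_inner \<Rightarrow>\<^sub>L 'a"
  assumes A: "self_adjoint A" and "0 \<le> K"
    and K: "\<And>t. t \<in> real_spectrum A \<Longrightarrow> \<bar>poly p t\<bar> \<le> K"
  shows "norm (op_poly p A) \<le> K"
proof (cases "\<exists>x::'a. x \<noteq> 0")
  case False
  then have "op_poly p A = 0"
    by (intro blinfun_eqI) auto
  with \<open>0 \<le> K\<close> show ?thesis
    by simp
next
  case True
  then obtain x\<^sub>0 :: 'a where x0: "x\<^sub>0 \<noteq> 0" ..
  have root: "\<exists>t\<in>real_spectrum A. poly (q * q - [:(norm (op_poly q A))\<^sup>2:]) t = 0"
    if "q * q - [:(norm (op_poly q A))\<^sup>2:] \<noteq> 0" for q
  proof (rule ccontr)
    assume "\<not> ?thesis"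
    with op_poly_bounded_below [OF A that] obtain c where "0 < c"
      and c: "\<And>x. c * norm x \<le> norm (op_poly (q * q - [:(norm (op_poly q A))\<^sup>2:]) A x)"
      by blast
    show False
      using square_minus_norm_not_bounded_below [OF self_adjoint_op_poly [OF A] x0 \<open>0 < c\<close>, of q] c
      by (auto simp: op_poly_diff op_poly_mult op_poly_const blinfun.diff_left blinfun.scaleR_left not_less
          simp flip: not_le)
  qed
  \<comment> \<open>Applying \<open>root\<close> to the identity polynomial shows that the real
    spectrum is nonempty.\<close>
  have "[:0, 1:] * [:0, 1:] - [:c:] \<noteq> 0" for c :: real
    by simp
  then obtain t\<^sub>0 where t0: "t\<^sub>0 \<in> real_spectrum A"
    using root by blast
  show ?thesis
  proof (rule ccontr)
    assume "\<not> ?thesis"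
    then have "K\<^sup>2 < (norm (op_poly p A))\<^sup>2"
      using \<open>0 \<le> K\<close> by (simp add: power_strict_mono)
    then have ne: "poly (p * p - [:(norm (op_poly p A))\<^sup>2:]) t \<noteq> 0" if "t \<in> real_spectrum A" for t
      using power_mono [OF K [OF that], of 2] by (simp add: power2_eq_square)
    \<comment> \<open>A point \<open>t\<^sub>0\<close> of the spectrum rules out the zero
      polynomial, to which \<open>root\<close> does not apply.\<close>
    then have "p * p - [:(norm (op_poly p A))\<^sup>2:] \<noteq> 0"
      using t0 by force
    then show False
      using root ne by blast
  qed
qed

section \<open>Continuous functional calculus\<close>

text \<open>Weierstrass approximation with error below \<open>1 / (k + 1)\<close> at stage
  \<open>k\<close>, phrased by sequences to match \<open>fun_calc\<close>.\<close>

lemma poly_uniform_approximation: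
  fixes f :: "real \<Rightarrow> real"
  assumes "continuous_on {a..b} f"
  obtains q where "uniform_limit {a..b} (\<lambda>k. poly (q k)) f sequentially"
proof -
  have "\<exists>p. \<forall>t\<in>{a..b}. \<bar>f t - poly p t\<bar> < inverse (real (Suc k))" for k
  proof -
    obtain g where g: "real_polynomial_function g" "\<And>t. t \<in> {a..b} \<Longrightarrow> \<bar>f t - g t\<bar> < inverse (real (Suc k))"
      using Stone_Weierstrass_real_polynomial_function [OF compact_Icc assms, of "inverse (real (Suc k))"]
      by auto
    then obtain c n where "g = (\<lambda>t. \<Sum>i\<le>n. c i * t ^ i)"
      using real_polynomial_function_iff_sum by blast
    then have "g = poly (\<Sum>i\<le>n. monom (c i) i)"
      by (simp add: poly_sum poly_monom fun_eq_iff)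
    with g(2) show ?thesis
      by blast
  qed
  then obtain q where q: "\<And>k t. t \<in> {a..b} \<Longrightarrow> \<bar>f t - poly (q k) t\<bar> < inverse (real (Suc k))"
    by metis
  have "uniform_limit {a..b} (\<lambda>k. poly (q k)) f sequentially"
  proof (rule uniform_limitI)
    fix e :: real assume "0 < e"
    then have "\<forall>\<^sub>F k in sequentially. inverse (real (Suc k)) < e"
      using LIMSEQ_inverse_real_of_nat by (rule order_tendstoD(2) [rotated])
    then show "\<forall>\<^sub>F k in sequentially. \<forall>t\<in>{a..b}. dist (poly (q k) t) (f t) < e"
    proof eventually_elim
      case (elim k)
      show ?case
        using q [of _ k] elim by (force simp: dist_real_def abs_minus_commute)
    qed
  qed
  then show ?thesis
    by (rule that)
qed

text \<open>\<open>norm_op_poly_le\<close> turns smallness of \<open>p k - q k\<close> on the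
  spectrum into smallness in operator norm; thus the limit does not depend on the approximating
  sequence.\<close>

lemma op_poly_diff_tendsto_0:
  assumes A: "self_adjoint A"
    and "uniform_limit (real_spectrum A) (\<lambda>k. poly (p k)) f F"
    and "uniform_limit (real_spectrum A) (\<lambda>k. poly (q k)) f F"
  shows "((\<lambda>k. op_poly (p k) A - op_poly (q k) A) \<longlongrightarrow> 0) F"
proof (rule tendstoI)
  fix e :: real assume "0 < e"
  then have "\<forall>\<^sub>F k in F. \<forall>t\<in>real_spectrum A. dist (poly (p k) t) (f t) < e / 4"
    "\<forall>\<^sub>F k in F. \<forall>t\<in>real_spectrum A. dist (poly (q k) t) (f t) < e / 4"
    using uniform_limitD [OF assms(2), of "e / 4"] uniform_limitD [OF assms(3), of "e / 4"] by simp_all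
  then show "\<forall>\<^sub>F k in F. dist (op_poly (p k) A - op_poly (q k) A) 0 < e"
  proof eventually_elim
    case (elim k)
    have "norm (op_poly (p k - q k) A) \<le> e / 2"
    proof (rule norm_op_poly_le [OF A])
      fix t assume "t \<in> real_spectrum A"
      then have "dist (poly (p k) t) (f t) < e / 4" "dist (poly (q k) t) (f t) < e / 4"
        using elim by blast+
      then show "\<bar>poly (p k - q k) t\<bar> \<le> e / 2"
        by (simp add: dist_real_def abs_if split: if_splits)
    qed (use \<open>0 < e\<close> in simp)
    then show ?case
      using \<open>0 < e\<close> by (simp add: op_poly_diff)
  qed
qed

lemma convergent_op_poly:
  fixes A :: "'a::complex_hilbert_space \<Rightarrow>\<^sub>L 'a"
  assumes A: "self_adjoint A"
    and lim: "uniform_limit (real_spectrum A) (\<lambda>k. poly (q k)) f sequentially"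
  shows "convergent (\<lambda>k. op_poly (q k) A)"
proof (rule Cauchy_convergent, rule metric_CauchyI)
  fix e :: real assume "0 < e"
  then have "\<forall>\<^sub>F k in sequentially. \<forall>t\<in>real_spectrum A. dist (poly (q k) t) (f t) < e / 4"
    using uniform_limitD [OF lim, of "e / 4"] by simp
  then obtain N where N: "\<And>k t. N \<le> k \<Longrightarrow> t \<in> real_spectrum A \<Longrightarrow> dist (poly (q k) t) (f t) < e / 4"
    by (auto simp: eventually_sequentially)
  have "dist (op_poly (q j) A) (op_poly (q k) A) < e" if "N \<le> j" "N \<le> k" for j k
  proof -
    have "norm (op_poly (q j - q k) A) \<le> e / 2"
    proof (rule norm_op_poly_le [OF A])
      fix t assume "t \<in> real_spectrum A"
      then have "dist (poly (q j) t) (f t) < e / 4" "dist (poly (q k) t) (f t) < e / 4"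
        using N that by blast+
      then show "\<bar>poly (q j - q k) t\<bar> \<le> e / 2"
        by (simp add: dist_real_def abs_if split: if_splits)
    qed (use \<open>0 < e\<close> in simp)
    then show ?thesis
      using \<open>0 < e\<close> by (simp add: op_poly_diff dist_norm)
  qed
  then show "\<exists>N. \<forall>j\<ge>N. \<forall>k\<ge>N. dist (op_poly (q j) A) (op_poly (q k) A) < e"
    by blast
qed

text \<open>Justifies the definite description in \<open>fun_calc\<close> as soon as one
  approximating sequence exists.\<close>

lemma op_poly_tendsto_fun_calc:
  fixes A :: "'a::complex_hilbert_space \<Rightarrow>\<^sub>L 'a"
  assumes A: "self_adjoint A"
    and p: "uniform_limit (real_spectrum A) (\<lambda>k. poly (p k)) f sequentially"
  shows "(\<lambda>k. op_poly (p k) A) \<longlonglongrightarrow> fun_calc f A"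
proof -
  obtain T where T: "(\<lambda>k. op_poly (p k) A) \<longlonglongrightarrow> T"
    using convergent_op_poly [OF assms] by (auto simp: convergent_def)
  have all: "(\<lambda>k. op_poly (q k) A) \<longlonglongrightarrow> T"
    if "uniform_limit (real_spectrum A) (\<lambda>k. poly (q k)) f sequentially" for q
    using tendsto_add [OF op_poly_diff_tendsto_0 [OF A that p] T] by simp
  \<comment> \<open>Any candidate must be the limit along \<open>p\<close>, hence equals
    \<open>T\<close>; without such a \<open>p\<close> the defining condition would be
    vacuous.\<close>
  have "fun_calc f A = T"
    unfolding fun_calc_def using all p by (blast intro: the_equality LIMSEQ_unique)
  with T show ?thesis
    by simp
qed

lemma fun_calc_poly:
  fixes A :: "'a::complex_hilbert_space \<Rightarrow>\<^sub>L 'a"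
  assumes "self_adjoint A"
  shows "fun_calc (poly p) A = op_poly p A"
  using op_poly_tendsto_fun_calc [OF assms, of "\<lambda>_. p" "poly p"]
  by (auto intro!: LIMSEQ_unique [OF _ tendsto_const] uniform_limit_const)

section \<open>Functional calculus for functions continuous on an interval enclosing the
  spectrum\<close>

context
  fixes A :: "'a::complex_hilbert_space \<Rightarrow>\<^sub>L 'a" and a b :: real
  assumes A: "self_adjoint A" and ab: "op_between a A b"
begin

lemma fun_calc_approximation:
  assumes "continuous_on {a..b} f"
  obtains q where "uniform_limit (real_spectrum A) (\<lambda>k. poly (q k)) f sequentially"
    "(\<lambda>k. op_poly (q k) A) \<longlonglongrightarrow> fun_calc f A"
proof -
  obtain q where "uniform_limit {a..b} (\<lambda>k. poly (q k)) f sequentially"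
    using assms by (rule poly_uniform_approximation)
  then have "uniform_limit (real_spectrum A) (\<lambda>k. poly (q k)) f sequentially"
    by (rule uniform_limit_on_subset) (rule real_spectrum_subset [OF A ab])
  with op_poly_tendsto_fun_calc [OF A this] show ?thesis
    by (rule that [rotated])
qed

lemma self_adjoint_fun_calc:
  assumes "continuous_on {a..b} f"
  shows "self_adjoint (fun_calc f A)"
proof -
  obtain q where "(\<lambda>k. op_poly (q k) A) \<longlonglongrightarrow> fun_calc f A"
    using assms by (rule fun_calc_approximation)
  then show ?thesis
    by (rule self_adjoint_LIMSEQ [rotated]) (rule self_adjoint_op_poly [OF A])
qed

lemma fun_calc_diff:
  assumes f: "continuous_on {a..b} f" and g: "continuous_on {a..b} g"
  shows "fun_calc (\<lambda>t. f t - g t) A = fun_calc f A - fun_calc g A"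
proof -
  obtain p where p: "uniform_limit (real_spectrum A) (\<lambda>k. poly (p k)) f sequentially"
    "(\<lambda>k. op_poly (p k) A) \<longlonglongrightarrow> fun_calc f A"
    using f by (rule fun_calc_approximation)
  obtain q where q: "uniform_limit (real_spectrum A) (\<lambda>k. poly (q k)) g sequentially"
    "(\<lambda>k. op_poly (q k) A) \<longlonglongrightarrow> fun_calc g A"
    using g by (rule fun_calc_approximation)
  have "poly (p k - q k) = (\<lambda>t. poly (p k) t - poly (q k) t)" for k
    by auto
  then have "uniform_limit (real_spectrum A) (\<lambda>k. poly (p k - q k)) (\<lambda>t. f t - g t) sequentially"
    using uniform_limit_minus [OF p(1) q(1)] by simp
  then have "(\<lambda>k. op_poly (p k - q k) A) \<longlonglongrightarrow> fun_calc (\<lambda>t. f t - g t) A"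
    by (rule op_poly_tendsto_fun_calc [OF A])
  moreover have "(\<lambda>k. op_poly (p k - q k) A) \<longlonglongrightarrow> fun_calc f A - fun_calc g A"
    unfolding op_poly_diff by (intro tendsto_diff p q)
  ultimately show ?thesis
    by (rule LIMSEQ_unique)
qed

text \<open>Transfers the convex case to the concave one; obtained by writing \<open>- f\<close> as
  \<open>0 - f\<close>.\<close>

lemma fun_calc_uminus:
  assumes f: "continuous_on {a..b} f"
  shows "fun_calc (\<lambda>t. - f t) A = - fun_calc f A"
proof -
  have "poly (0 :: real poly) = (\<lambda>t. 0)"
    by auto
  then have "fun_calc (\<lambda>t. 0) A = 0"
    using fun_calc_poly [OF A, of 0] by (simp add: op_poly_0)
  then show ?thesis
    using fun_calc_diff [OF continuous_on_const f, of 0] by simp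
qed

text \<open>If \<open>0 \<le> g \<le> K\<close>, then \<open>\<parallel>K - g(A)\<parallel> \<le> K\<close>, hence \<open>g(A) \<ge> 0\<close>.\<close>

lemma fun_calc_nonneg:
  assumes g: "continuous_on {a..b} g" and nonneg: "\<And>t. t \<in> {a..b} \<Longrightarrow> 0 \<le> g t"
  shows "0 \<le> Re (cinner (fun_calc g A x) x)"
proof -
  have "compact (g ` {a..b})"
    using g compact_Icc by (rule compact_continuous_image)
  then obtain K where K: "0 < K" "\<And>t. t \<in> {a..b} \<Longrightarrow> \<bar>g t\<bar> \<le> K"
    by (auto simp: bounded_pos dest!: compact_imp_bounded)
  obtain q where q: "uniform_limit (real_spectrum A) (\<lambda>k. poly (q k)) g sequentially"
    "(\<lambda>k. op_poly (q k) A) \<longlonglongrightarrow> fun_calc g A"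
    using g by (rule fun_calc_approximation)
  \<comment> \<open>On the spectrum \<open>K - g\<close> lies between 0 and \<open>K\<close>. The
    polynomials reach this up to \<open>e\<close>, and the bound passes to the limit.\<close>
  have "norm (K *\<^sub>R id_blinfun - fun_calc g A) \<le> K"
  proof (rule field_le_epsilon)
    fix e :: real assume "0 < e"
    with q(1) have "\<forall>\<^sub>F k in sequentially. \<forall>t\<in>real_spectrum A. dist (poly (q k) t) (g t) < e"
      by (rule uniform_limitD)
    then have "\<forall>\<^sub>F k in sequentially. norm (K *\<^sub>R id_blinfun - op_poly (q k) A) \<le> K + e"
    proof eventually_elim
      case (elim k)
      have "norm (op_poly ([:K:] - q k) A) \<le> K + e"
      proof (rule norm_op_poly_le [OF A])
        fix t assume t: "t \<in> real_spectrum A"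
        then have "t \<in> {a..b}"
          using real_spectrum_subset [OF A ab] by blast
        then have "0 \<le> g t" "\<bar>g t\<bar> \<le> K"
          using nonneg K by auto
        moreover have "dist (poly (q k) t) (g t) < e"
          using elim t by blast
        ultimately show "\<bar>poly ([:K:] - q k) t\<bar> \<le> K + e"
          by (simp add: dist_real_def abs_if split: if_splits)
      qed (use \<open>0 < e\<close> K in simp)
      then show ?case
        by (simp add: op_poly_diff op_poly_const)
    qed
    then show "norm (K *\<^sub>R id_blinfun - fun_calc g A) \<le> K + e"
      by (intro tendsto_upperbound [OF tendsto_norm [OF tendsto_diff [OF tendsto_const q(2)]]]) auto
  qed
  \<comment> \<open>The left side is \<open>K * (norm x)\<^sup>2\<close> minus the form of
    \<open>g(A)\<close>, the final bound is \<open>K * (norm x)\<^sup>2\<close>.\<close>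
  have "Re (cinner ((K *\<^sub>R id_blinfun - fun_calc g A) x) x) \<le> norm ((K *\<^sub>R id_blinfun - fun_calc g A) x) * norm x"
    by (rule Re_cinner_le)
  also have "\<dots> \<le> K * norm x * norm x"
    by (intro mult_right_mono order_trans [OF norm_blinfun] \<open>norm (K *\<^sub>R id_blinfun - fun_calc g A) \<le> K\<close>) auto
  finally show ?thesis
    by (simp add: blinfun.diff_left blinfun.scaleR_left cinner.diff_left cinner.scaleR_left cinner_self
        power2_eq_square)
qed

lemma fun_calc_mono:
  assumes f: "continuous_on {a..b} f" and g: "continuous_on {a..b} g"
    and le: "\<And>t. t \<in> {a..b} \<Longrightarrow> f t \<le> g t"
  shows "fun_calc f A \<le>\<^sub>o\<^sub>p fun_calc g A"
proof -
  have "0 \<le> Re (cinner (fun_calc (\<lambda>t. g t - f t) A x) x)" for x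
    by (rule fun_calc_nonneg) (auto intro: continuous_on_diff f g simp: le)
  then show ?thesis
    by (simp add: op_le_iff self_adjoint_fun_calc f g fun_calc_diff blinfun.diff_left cinner.diff_left)
qed

end

section \<open>Convex combinations of operators\<close>

text \<open>Outside the interval, one endpoint is a convex combination of \<open>t\<close> and the
  other endpoint. The chord agrees with \<open>f\<close> at both endpoints, so convexity leaves the
  chord below \<open>f\<close> at \<open>t\<close>.\<close>

lemma convex_chord:
  fixes f :: "real \<Rightarrow> real"
  assumes f: "convex_on I f" and "L < U" "L \<in> I" "U \<in> I"
  obtains \<alpha> \<beta> where "\<And>t. t \<in> {L..U} \<Longrightarrow> f t \<le> \<alpha> + \<beta> * t"
    and "\<And>t. t \<in> I \<Longrightarrow> t \<le> L \<or> U \<le> t \<Longrightarrow> \<alpha> + \<beta> * t \<le> f t"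
proof -
  define \<beta> where "\<beta> = (f U - f L) / (U - L)"
  define l where "l t = f L - \<beta> * L + \<beta> * t" for t
  have l: "l ((1 - s) * x + s * y) = (1 - s) * l x + s * l y" for s x y
    by (simp add: l_def algebra_simps)
  have lL: "l L = f L"
    by (simp add: l_def)
  have "\<beta> * (U - L) = f U - f L"
    using \<open>L < U\<close> by (simp add: \<beta>_def)
  then have lU: "l U = f U"
    by (simp add: l_def algebra_simps)
  \<comment> \<open>The strict \<open>s < 1\<close> gives \<open>x\<close> a positive weight, which
    can be cancelled later.\<close>
  have comb: "\<exists>s. 0 \<le> s \<and> s < 1 \<and> y = (1 - s) * x + s * z" if "x \<le> y" "y < z" for x y z :: real
  proof -
    define s where "s = (y - x) / (z - x)"
    have "s * (z - x) = y - x"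
      using that by (simp add: s_def)
    then have "y = (1 - s) * x + s * z"
      by (simp add: algebra_simps)
    moreover have "0 \<le> s" "s < 1"
      using that by (simp_all add: s_def)
    ultimately show ?thesis
      by blast
  qed
  have conv: "f ((1 - s) * x + s * y) \<le> (1 - s) * f x + s * f y"
    if "0 \<le> s" "s \<le> 1" "x \<in> I" "y \<in> I" for s x y
    using convex_onD [OF f, of s x y] that by simp
  have inner: "f t \<le> l t" if t: "t \<in> {L..U}" for t
  proof (cases "t = U")
    case False
    with t obtain s where "0 \<le> s" "s < 1" "t = (1 - s) * L + s * U"
      using comb [of L t U] by auto
    with conv [of s L U] assms show ?thesis
      by (simp add: l lL lU)
  qed (simp add: lU)
  have left: "l t \<le> f t" if t: "t \<in> I" "t \<le> L" for t
  proof -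
    obtain s where s: "0 \<le> s" "s < 1" "L = (1 - s) * t + s * U"
      using comb [of t L U] t \<open>L < U\<close> by auto
    then have "(1 - s) * l t + s * l U \<le> (1 - s) * f t + s * f U"
      using conv [of s t U] t assms l [of s t U] lL by simp
    with s show ?thesis
      by (simp add: lU)
  qed
  have right: "l t \<le> f t" if t: "t \<in> I" "U \<le> t" for t
  proof -
    \<comment> \<open>Negation reverses the order, so that the positive weight \<open>1 - s\<close>
      again falls on \<open>t\<close>.\<close>
    obtain s where s: "0 \<le> s" "s < 1" "- U = (1 - s) * - t + s * - L"
      using comb [of "- t" "- U" "- L"] t \<open>L < U\<close> by auto
    then have U: "(1 - s) * t + s * L = U"
      by simp
    have "(1 - s) * l t + s * l L \<le> (1 - s) * f t + s * f L"
      using conv [of s t L] s t assms l [of s t L] lU by (simp add: U)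
    with s show ?thesis
      by (simp add: lL)
  qed
  show ?thesis
    by (rule that [of "f L - \<beta> * L" \<beta>]) (use inner left right in \<open>auto simp: l_def\<close>)
qed

lemma fun_calc_convex_combination_le:
  fixes A B :: "'a::complex_hilbert_space \<Rightarrow>\<^sub>L 'a" and f :: "real \<Rightarrow> real"
  assumes A: "self_adjoint A" "op_between n A N" and B: "self_adjoint B" "op_between m B M"
    and "0 < n" "n < N" "0 < m" "m < M" and f: "convex_on {0<..} f" and v: "0 < v" "v < 1"
    and disj: "{(1 - v) * n + v * m .. (1 - v) * N + v * M} \<inter> {n..N} = {}"
      "{(1 - v) * n + v * m .. (1 - v) * N + v * M} \<inter> {m..M} = {}"
  shows "fun_calc f ((1 - v) *\<^sub>R A + v *\<^sub>R B) \<le>\<^sub>o\<^sub>p (1 - v) *\<^sub>R fun_calc f A + v *\<^sub>R fun_calc f B"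
proof -
  define L U C where "L = (1 - v) * n + v * m" and "U = (1 - v) * N + v * M"
    and "C = (1 - v) *\<^sub>R A + v *\<^sub>R B"
  have "0 < L"
    using assms by (simp add: L_def add_pos_pos)
  have "L < U"
    unfolding L_def U_def using assms by (intro add_strict_mono mult_strict_left_mono) auto
  have C: "self_adjoint C" "op_between L C U"
    unfolding C_def L_def U_def using A B v
    by (auto intro: self_adjoint_add self_adjoint_scaleR op_between_convex_combination)
  \<comment> \<open>A convex function on an open interval is continuous, as the functional calculus
    requires.\<close>
  have cont: "continuous_on {s..t} f" if "0 < s" for s t
    by (rule continuous_on_subset [OF convex_on_continuous [OF open_greaterThan f]]) (use that in auto)
  obtain \<alpha> \<beta> where inside: "\<And>t. t \<in> {L..U} \<Longrightarrow> f t \<le> \<alpha> + \<beta> * t"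
    and outside: "\<And>t. t \<in> {0<..} \<Longrightarrow> t \<le> L \<or> U \<le> t \<Longrightarrow> \<alpha> + \<beta> * t \<le> f t"
    using convex_chord [OF f \<open>L < U\<close>] \<open>0 < L\<close> \<open>L < U\<close> by auto
  define l where "l = [:\<alpha>, \<beta>:]"
  have l: "poly l t = \<alpha> + \<beta> * t" for t
    by (simp add: l_def)
  have contl: "continuous_on S (poly l)" for S
    by (intro continuous_intros)
  \<comment> \<open>Disjointness places every such \<open>t\<close> outside \<open>{L..U}\<close>,
    where the chord lies below \<open>f\<close>.\<close>
  have off: "poly l t \<le> f t" if "t \<in> {n..N} \<or> t \<in> {m..M}" for t
  proof -
    have "t \<notin> {L..U}"
      using that disj unfolding L_def U_def by blast
    moreover have "0 < t"
      using that \<open>0 < n\<close> \<open>0 < m\<close> by auto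
    ultimately show ?thesis
      using outside [of t] by (auto simp: l)
  qed
  have "fun_calc f C \<le>\<^sub>o\<^sub>p op_poly l C"
    using fun_calc_mono [OF C cont contl] inside \<open>0 < L\<close> by (simp add: l fun_calc_poly C)
  \<comment> \<open>Here affinity of \<open>l\<close> matters: its constant term is preserved
    because the weights sum to 1.\<close>
  also have "op_poly l C = (1 - v) *\<^sub>R op_poly l A + v *\<^sub>R op_poly l B"
    by (intro blinfun_eqI) (simp add: l_def C_def op_poly_pCons_apply op_poly_0 blinfun.add_left
        blinfun.diff_left blinfun.scaleR_left blinfun.scaleR_right algebra_simps)
  also have "(1 - v) *\<^sub>R op_poly l A + v *\<^sub>R op_poly l B \<le>\<^sub>o\<^sub>p (1 - v) *\<^sub>R fun_calc f A + v *\<^sub>R fun_calc f B"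
  proof (rule op_le_convex_combination)
    show "op_poly l A \<le>\<^sub>o\<^sub>p fun_calc f A"
      using fun_calc_mono [OF A contl cont] off \<open>0 < n\<close> by (simp add: fun_calc_poly A)
    show "op_poly l B \<le>\<^sub>o\<^sub>p fun_calc f B"
      using fun_calc_mono [OF B contl cont] off \<open>0 < m\<close> by (simp add: fun_calc_poly B)
  qed (use v in auto)
  finally (op_le_trans) show ?thesis
    unfolding C_def .
qed

theorem theorem2p1:
  fixes A B :: "'a::complex_hilbert_space \<Rightarrow>\<^sub>L 'a"
    and n N m M :: real
    and f :: "real \<Rightarrow> real"
  assumes "positive_op A" and "positive_op B"
    and "0 < n" and "n < N" and "0 < m" and "m < M"
    and "op_between n A N" and "op_between m B M"
    and "\<And>t. 0 < t \<Longrightarrow> 0 \<le> f t"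
  shows
    "(convex_on {0<..} f \<longrightarrow>
       (\<forall>v. 0 < v \<and> v < 1 \<and>
          {(1 - v) * n + v * m .. (1 - v) * N + v * M} \<inter> {n..N} = {} \<and>
          {(1 - v) * n + v * m .. (1 - v) * N + v * M} \<inter> {m..M} = {} \<longrightarrow>
          fun_calc f ((1 - v) *\<^sub>R A + v *\<^sub>R B)
            \<le>\<^sub>o\<^sub>p (1 - v) *\<^sub>R fun_calc f A + v *\<^sub>R fun_calc f B) \<and>
       ({(n + m) / 2 .. (N + M) / 2} \<inter> {n..N} = {} \<and>
        {(n + m) / 2 .. (N + M) / 2} \<inter> {m..M} = {} \<longrightarrow>
          fun_calc f ((1 / 2) *\<^sub>R (A + B))
            \<le>\<^sub>o\<^sub>p (1 / 2) *\<^sub>R (fun_calc f A + fun_calc f B))) \<and>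
     (concave_on {0<..} f \<longrightarrow>
       (\<forall>v. 0 < v \<and> v < 1 \<and>
          {(1 - v) * n + v * m .. (1 - v) * N + v * M} \<inter> {n..N} = {} \<and>
          {(1 - v) * n + v * m .. (1 - v) * N + v * M} \<inter> {m..M} = {} \<longrightarrow>
          (1 - v) *\<^sub>R fun_calc f A + v *\<^sub>R fun_calc f B
            \<le>\<^sub>o\<^sub>p fun_calc f ((1 - v) *\<^sub>R A + v *\<^sub>R B)) \<and>
       ({(n + m) / 2 .. (N + M) / 2} \<inter> {n..N} = {} \<and>
        {(n + m) / 2 .. (N + M) / 2} \<inter> {m..M} = {} \<longrightarrow>
          (1 / 2) *\<^sub>R (fun_calc f A + fun_calc f B)
            \<le>\<^sub>o\<^sub>p fun_calc f ((1 / 2) *\<^sub>R (A + B))))"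
proof -
  have A: "self_adjoint A" and B: "self_adjoint B"
    using assms(1,2) by (simp_all add: positive_op_imp_self_adjoint)
  let ?disj = "\<lambda>v. {(1 - v) * n + v * m .. (1 - v) * N + v * M} \<inter> {n..N} = {} \<and>
    {(1 - v) * n + v * m .. (1 - v) * N + v * M} \<inter> {m..M} = {}"
  note conv = fun_calc_convex_combination_le [OF A assms(7) B assms(8) assms(3-6)]
  have convex: "fun_calc f ((1 - v) *\<^sub>R A + v *\<^sub>R B) \<le>\<^sub>o\<^sub>p (1 - v) *\<^sub>R fun_calc f A + v *\<^sub>R fun_calc f B"
    if "convex_on {0<..} f" "0 < v" "v < 1" "?disj v" for v
    using conv that by blast
  have concave: "(1 - v) *\<^sub>R fun_calc f A + v *\<^sub>R fun_calc f B \<le>\<^sub>o\<^sub>p fun_calc f ((1 - v) *\<^sub>R A + v *\<^sub>R B)"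
    if f: "concave_on {0<..} f" and v: "0 < v" "v < 1" and disj: "?disj v" for v
  proof -
    have f': "convex_on {0<..} (\<lambda>t. - f t)"
      using f by (simp add: concave_on_def)
    have "continuous_on {0<..} f"
      using continuous_on_minus [OF convex_on_continuous [OF open_greaterThan f']] by simp
    then have cont: "continuous_on {s..t} f" if "0 < s" for s t
      by (rule continuous_on_subset) (use that in auto)
    let ?C = "(1 - v) *\<^sub>R A + v *\<^sub>R B"
    have C: "self_adjoint ?C" "op_between ((1 - v) * n + v * m) ?C ((1 - v) * N + v * M)"
      using A B v assms(7,8)
      by (auto intro: self_adjoint_add self_adjoint_scaleR op_between_convex_combination)
    have "0 < (1 - v) * n + v * m"
      using v assms(3,5) by (simp add: add_pos_pos)
    \<comment> \<open>All three intervals start at a positive number, so \<open>f\<close> is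
      continuous on each of them.\<close>
    then have eq: "fun_calc (\<lambda>t. - f t) A = - fun_calc f A" "fun_calc (\<lambda>t. - f t) B = - fun_calc f B"
      "fun_calc (\<lambda>t. - f t) ?C = - fun_calc f ?C"
      using fun_calc_uminus [OF A assms(7) cont] fun_calc_uminus [OF B assms(8) cont]
        fun_calc_uminus [OF C cont] assms(3,5) by simp_all
    have "- fun_calc f ?C \<le>\<^sub>o\<^sub>p - ((1 - v) *\<^sub>R fun_calc f A + v *\<^sub>R fun_calc f B)"
      using conv [OF f' v] disj unfolding eq by (simp add: algebra_simps)
    then show ?thesis
      by (simp only: op_le_uminus_iff)
  qed
  \<comment> \<open>Brings the instance \<open>v = 1 / 2\<close> into midpoint form.\<close>
  have half: "(1 - 1 / 2) * n + 1 / 2 * m = (n + m) / 2" "(1 - 1 / 2) * N + 1 / 2 * M = (N + M) / 2"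
    "(1 - 1 / 2) *\<^sub>R S + (1 / 2) *\<^sub>R T = (1 / 2) *\<^sub>R (S + T)" for S T :: "'a \<Rightarrow>\<^sub>L 'a"
    by (simp_all add: scaleR_add_right add_divide_distrib)
  show ?thesis
    using convex concave convex [of "1 / 2", unfolded half] concave [of "1 / 2", unfolded half]
    by simp
qed

end
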